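(* Let $\Omega^s$ be the set of all $(x,s,\theta)$ with $x\in Q$, $s\in\{0,1\}^{p\times p}$, $\theta\in\mathbb{R}^p$ satisfying $\sum_{i\in P}s_{ij}=j-1$ for all $j\in P$; $s_{i,j+1}-s_{ij}\ge 0$ for all $i,j\in P$, $j<p$; $C^i x\le\theta_j+M s_{ij}$ for all $i,j\in P$; $\theta_j\ge\theta_{j+1}$ for all $j\in P$, $j<p$. Let $\Omega^z$ be the set of all $(x,z,\theta)$ with $x\in Q$, $z\in\{0,1\}^{p\times p}$, $\theta\in\mathbb{R}^p$ satisfying $\sum_{i\in P}z_{ij}=1$ for all $j\in P$; $\sum_{j\in P}z_{ij}=1$ for all $i\in P$; $C^i x\le \theta_j+M\bigl(1-\sum_{k\ge j}z_{ik}\bigr)$ for all $i,j\in P$; $\theta_j\ge\theta_{j+1}$ for all $j\in P$, $j<p$. The objective value of a point of either set is $\sum_{j\in P}\omega_j\theta_j$. Then for each solution $(x,s,\theta)\in\Omega^s$ there exists $(x,z,\theta)\in\Omega^z$ with equal objective value, and conversely (for each $(x,z,\theta)\in\Omega^z$ there exists $(x,s,\theta)\in\Omega^s$ with equal objective value).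
   Context: $P=\{1,\dots,p\}$. $Q\subseteq\mathbb{R}^n$ is the feasible set of a combinatorial optimization problem (a combinatorial object representable by a system of linear inequalities). $C\in\mathbb{R}^{p\times n}$ is a matrix whose rows $C^i$, $i\in P$, are the cost vectors of $p$ objective (cost) functions $x\mapsto C^i x$. $\omega=(\omega_j)_{j\in P}$ is a vector of non-negative weights. $M$ is a non-negative upper bound on the value of all the cost functions, i.e. $M\ge 0$ and $C^i x\le M$ for all $x\in Q$, $i\in P$. *)

theory Defs imports "HOL-Analysis.Analysis" begin

text \<open>The index set is \<open>P = {1..p}\<close>. Vectors in \<open>\<real>\<^sup>p\<close> and \<open>p \<times> p\<close> matrices are extensional functions
  on \<open>P\<close> and \<open>P \<times> P\<close>, so that a point has no components outside the index range. The cost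
  matrix is given by its rows, and the cost \<open>C\<^sup>i x\<close> is the inner product \<open>C i \<bullet> x\<close>.\<close>

definition Omega_s ::
  "(real ^ 'n) set \<Rightarrow> nat \<Rightarrow> (nat \<Rightarrow> real ^ 'n) \<Rightarrow> real
    \<Rightarrow> ((real ^ 'n) \<times> (nat \<times> nat \<Rightarrow> real) \<times> (nat \<Rightarrow> real)) set" where
  "Omega_s Q p C M = {(x, s, \<theta>).
     x \<in> Q \<and> s \<in> {1..p} \<times> {1..p} \<rightarrow>\<^sub>E {0, 1} \<and> \<theta> \<in> {1..p} \<rightarrow>\<^sub>E UNIV \<and>
     (\<forall>j\<in>{1..p}. (\<Sum>i\<in>{1..p}. s (i, j)) = real j - 1) \<and>
     (\<forall>i\<in>{1..p}. \<forall>j\<in>{1..p}. j < p \<longrightarrow> s (i, j + 1) - s (i, j) \<ge> 0) \<and>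
     (\<forall>i\<in>{1..p}. \<forall>j\<in>{1..p}. C i \<bullet> x \<le> \<theta> j + M * s (i, j)) \<and>
     (\<forall>j\<in>{1..p}. j < p \<longrightarrow> \<theta> j \<ge> \<theta> (j + 1))}"

definition Omega_z ::
  "(real ^ 'n) set \<Rightarrow> nat \<Rightarrow> (nat \<Rightarrow> real ^ 'n) \<Rightarrow> real
    \<Rightarrow> ((real ^ 'n) \<times> (nat \<times> nat \<Rightarrow> real) \<times> (nat \<Rightarrow> real)) set" where
  "Omega_z Q p C M = {(x, z, \<theta>).
     x \<in> Q \<and> z \<in> {1..p} \<times> {1..p} \<rightarrow>\<^sub>E {0, 1} \<and> \<theta> \<in> {1..p} \<rightarrow>\<^sub>E UNIV \<and>
     (\<forall>j\<in>{1..p}. (\<Sum>i\<in>{1..p}. z (i, j)) = 1) \<and>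
     (\<forall>i\<in>{1..p}. (\<Sum>j\<in>{1..p}. z (i, j)) = 1) \<and>
     (\<forall>i\<in>{1..p}. \<forall>j\<in>{1..p}. C i \<bullet> x \<le> \<theta> j + M * (1 - (\<Sum>k\<in>{j..p}. z (i, k)))) \<and>
     (\<forall>j\<in>{1..p}. j < p \<longrightarrow> \<theta> j \<ge> \<theta> (j + 1))}"

definition objective_value ::
  "nat \<Rightarrow> (nat \<Rightarrow> real) \<Rightarrow> (real ^ 'n) \<times> (nat \<times> nat \<Rightarrow> real) \<times> (nat \<Rightarrow> real) \<Rightarrow> real" where
  "objective_value p \<omega> = (\<lambda>(x, y, \<theta>). \<Sum>j\<in>{1..p}. \<omega> j * \<theta> j)"

end

(* The two formulations are linked by s(i,j) = 1 - (sum over k >= j of z(i,k)): each row of s is a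
   0/1 step function and z marks the position of its step. With this substitution the two families
   of cost constraints coincide, and x and theta are left unchanged. *)
theory Submission imports Defs begin

text \<open>Nonnegativity bounds the partial sum by the total 1, while a single nonzero entry in
  \<open>B\<close> already contributes 1; so only 0 and 1 remain. This is what makes prefix sums
  along a row of \<open>z\<close> binary.\<close>

lemma partial_sum_of_binary_row:
  fixes f :: "nat \<Rightarrow> real"
  assumes "\<And>k. k \<in> A \<Longrightarrow> f k \<in> {0, 1}" "finite A" "sum f A = 1" "B \<subseteq> A"
  shows "sum f B \<in> {0, 1}"
proof -
  have nn: "f k \<ge> 0" if "k \<in> A" for k using assms(1)[OF that] by auto
  have le: "sum f B \<le> 1"
    using sum_mono2[of A B f] assms nn by auto
  show ?thesis
  proof (cases "\<forall>k\<in>B. f k = 0")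
    case True
    then show ?thesis by simp
  next
    case False
    then obtain k where k: "k \<in> B" "f k = 1" using assms(1,4) by blast
    have "f k \<le> sum f B"
      using k assms nn by (intro member_le_sum) (auto intro: finite_subset)
    then show ?thesis using le k by simp
  qed
qed

text \<open>Taking \<open>z\<close> as the difference of consecutive columns of \<open>s\<close>
  works because the prescribed column sums of \<open>s\<close> grow by exactly one per
  column.\<close>

lemma Omega_s_to_Omega_z:
  fixes Q :: "(real ^ 'n) set"
  assumes "(x, s, \<theta>) \<in> Omega_s Q p C M"
  shows "\<exists>z. (x, z, \<theta>) \<in> Omega_z Q p C M"
proof -
  let ?P = "{1..p}"
  have bin: "s (i, j) \<in> {0, 1}" if "i \<in> ?P" "j \<in> ?P" for i j
    using assms that by (auto simp: Omega_s_def)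
  have col: "(\<Sum>i\<in>?P. s (i, j)) = real j - 1" if "j \<in> ?P" for j
    using assms that by (auto simp: Omega_s_def)
  have mono: "s (i, j + 1) - s (i, j) \<ge> 0" if "i \<in> ?P" "j \<in> ?P" "j < p" for i j
    using assms that by (auto simp: Omega_s_def)
  have cost: "C i \<bullet> x \<le> \<theta> j + M * s (i, j)" if "i \<in> ?P" "j \<in> ?P" for i j
    using assms that by (auto simp: Omega_s_def)
  \<comment> \<open>Extending \<open>s\<close> by a column of ones makes the differences telescope over the whole row.\<close>
  define t where "t i j = (if j \<le> p then s (i, j) else 1)" for i j
  define z where "z = restrict (\<lambda>(i, j). t i (Suc j) - t i j) (?P \<times> ?P)"
  have z: "z (i, j) = t i (Suc j) - t i j" if "i \<in> ?P" "j \<in> ?P" for i j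
    using that by (simp add: z_def)
  \<comment> \<open>For \<open>j < p\<close>, monotonicity excludes the difference -1 of two binary
    entries; for \<open>j = p\<close> the difference is \<open>1 - s (i, p)\<close>.\<close>
  have zbin: "z (i, j) \<in> {0, 1}" if "i \<in> ?P" "j \<in> ?P" for i j
    using that bin[of i j] bin[of i "Suc j"] mono[of i j] by (auto simp: z t_def)
  have tail: "(\<Sum>k\<in>{j..p}. z (i, k)) = 1 - s (i, j)" if "i \<in> ?P" "j \<in> ?P" for i j
  proof -
    have "(\<Sum>k\<in>{j..p}. z (i, k)) = (\<Sum>k\<in>{j..p}. t i (Suc k) - t i k)"
      using that by (intro sum.cong) (auto simp: z)
    also have "\<dots> = t i (Suc p) - t i j"
      using that by (intro sum_Suc_diff) auto
    finally show ?thesis using that by (simp add: t_def)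
  qed
  \<comment> \<open>The added column of ones sums to \<open>p\<close>, so the formula persists at
    \<open>j = Suc p\<close>; the last column of \<open>z\<close> needs this case.\<close>
  have tcol: "(\<Sum>i\<in>?P. t i j) = real j - 1" if "1 \<le> j" "j \<le> Suc p" for j
    using that col[of j] by (cases "j \<le> p") (auto simp: t_def)
  have zcol: "(\<Sum>i\<in>?P. z (i, j)) = 1" if "j \<in> ?P" for j
  proof -
    have "(\<Sum>i\<in>?P. z (i, j)) = (\<Sum>i\<in>?P. t i (Suc j)) - (\<Sum>i\<in>?P. t i j)"
      unfolding sum_subtractf[symmetric] using that by (intro sum.cong) (auto simp: z)
    then show ?thesis using that tcol[of j] tcol[of "Suc j"] by simp
  qed
  \<comment> \<open>The full row sum is the tail from 1, that is \<open>1 - s (i, 1)\<close>. The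
    first column of \<open>s\<close> is nonnegative with sum 0, hence vanishes.\<close>
  have zrow: "(\<Sum>j\<in>?P. z (i, j)) = 1" if "i \<in> ?P" for i
  proof -
    have one: "1 \<in> ?P" using that by auto
    have "s (i, 1) \<ge> 0" if "i \<in> ?P" for i
      using bin[OF that one] by auto
    then have "s (i, 1) = 0"
      using col[OF one] that sum_nonneg_eq_0_iff[of ?P "\<lambda>i. s (i, 1)"] by simp
    then show ?thesis using tail[OF that one] that by simp
  qed
  have "z \<in> ?P \<times> ?P \<rightarrow>\<^sub>E {0, 1}"
    using zbin by (intro PiE_I) (force, auto simp: z_def)
  moreover have "C i \<bullet> x \<le> \<theta> j + M * (1 - (\<Sum>k\<in>{j..p}. z (i, k)))"
    if "i \<in> ?P" "j \<in> ?P" for i j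
    using cost[OF that] tail[OF that] by simp
  ultimately have "(x, z, \<theta>) \<in> Omega_z Q p C M"
    using assms zcol zrow unfolding Omega_s_def Omega_z_def by blast
  then show ?thesis by blast
qed

lemma Omega_z_to_Omega_s:
  fixes Q :: "(real ^ 'n) set"
  assumes "(x, z, \<theta>) \<in> Omega_z Q p C M"
  shows "\<exists>s. (x, s, \<theta>) \<in> Omega_s Q p C M"
proof -
  let ?P = "{1..p}"
  have bin: "z (i, j) \<in> {0, 1}" if "i \<in> ?P" "j \<in> ?P" for i j
    using assms that by (auto simp: Omega_z_def)
  have col: "(\<Sum>i\<in>?P. z (i, j)) = 1" if "j \<in> ?P" for j
    using assms that by (auto simp: Omega_z_def)
  have row: "(\<Sum>j\<in>?P. z (i, j)) = 1" if "i \<in> ?P" for i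
    using assms that by (auto simp: Omega_z_def)
  have cost: "C i \<bullet> x \<le> \<theta> j + M * (1 - (\<Sum>k\<in>{j..p}. z (i, k)))"
    if "i \<in> ?P" "j \<in> ?P" for i j
    using assms that by (auto simp: Omega_z_def)
  \<comment> \<open>The prefix stops strictly before \<open>j\<close>: the first column is an empty
    sum, and unit row sums make the prefix the complement of the tail from \<open>j\<close>.\<close>
  define s where "s = restrict (\<lambda>(i, j). \<Sum>k\<in>{1..<j}. z (i, k)) (?P \<times> ?P)"
  have s: "s (i, j) = (\<Sum>k\<in>{1..<j}. z (i, k))" if "i \<in> ?P" "j \<in> ?P" for i j
    using that by (simp add: s_def)
  have sbin: "s (i, j) \<in> {0, 1}" if "i \<in> ?P" "j \<in> ?P" for i j
    unfolding s[OF that]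
    using that bin row by (intro partial_sum_of_binary_row[of ?P]) auto
  have tail: "s (i, j) = 1 - (\<Sum>k\<in>{j..p}. z (i, k))" if "i \<in> ?P" "j \<in> ?P" for i j
  proof -
    have "?P = {1..<j} \<union> {j..p}" using that by auto
    then have "(\<Sum>k\<in>?P. z (i, k)) = (\<Sum>k\<in>{1..<j}. z (i, k)) + (\<Sum>k\<in>{j..p}. z (i, k))"
      by (simp add: sum.union_disjoint ivl_disj_int)
    then show ?thesis using row s that by simp
  qed
  have scol: "(\<Sum>i\<in>?P. s (i, j)) = real j - 1" if "j \<in> ?P" for j
  proof -
    have "(\<Sum>i\<in>?P. s (i, j)) = (\<Sum>i\<in>?P. \<Sum>k\<in>{1..<j}. z (i, k))"
      using that by (intro sum.cong) (auto simp: s)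
    also have "\<dots> = (\<Sum>k\<in>{1..<j}. \<Sum>i\<in>?P. z (i, k))"
      \<comment> \<open>Summing by columns of \<open>z\<close> first leaves \<open>j - 1\<close>
        columns, each of sum 1.\<close>
      by (rule sum.swap)
    also have "\<dots> = (\<Sum>k\<in>{1..<j}. 1)"
      using that by (intro sum.cong col) auto
    finally show ?thesis using that by (simp add: of_nat_diff)
  qed
  \<comment> \<open>Consecutive prefix sums differ by the single entry
    \<open>z (i, j)\<close>.\<close>
  have smono: "s (i, j + 1) - s (i, j) \<ge> 0" if "i \<in> ?P" "j \<in> ?P" "j < p" for i j
    using that bin[of i j] by (auto simp: s)
  have "s \<in> ?P \<times> ?P \<rightarrow>\<^sub>E {0, 1}"
    using sbin by (intro PiE_I) (force, auto simp: s_def)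
  moreover have "C i \<bullet> x \<le> \<theta> j + M * s (i, j)" if "i \<in> ?P" "j \<in> ?P" for i j
    using cost[OF that] tail[OF that] by simp
  ultimately have "(x, s, \<theta>) \<in> Omega_s Q p C M"
    using assms scol smono unfolding Omega_s_def Omega_z_def by blast
  then show ?thesis by blast
qed

theorem mainTheorem8:
  fixes Q :: "(real ^ 'n) set" and p :: nat and C :: "nat \<Rightarrow> real ^ 'n"
    and \<omega> :: "nat \<Rightarrow> real" and M :: real
  assumes "\<forall>j\<in>{1..p}. \<omega> j \<ge> 0"
    and "M \<ge> 0"
    and "\<forall>x\<in>Q. \<forall>i\<in>{1..p}. C i \<bullet> x \<le> M"
  shows "(\<forall>x s \<theta>. (x, s, \<theta>) \<in> Omega_s Q p C M \<longrightarrow>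
            (\<exists>z. (x, z, \<theta>) \<in> Omega_z Q p C M \<and>
                 objective_value p \<omega> (x, z, \<theta>) = objective_value p \<omega> (x, s, \<theta>))) \<and>
         (\<forall>x z \<theta>. (x, z, \<theta>) \<in> Omega_z Q p C M \<longrightarrow>
            (\<exists>s. (x, s, \<theta>) \<in> Omega_s Q p C M \<and>
                 objective_value p \<omega> (x, s, \<theta>) = objective_value p \<omega> (x, z, \<theta>)))"
proof -
  \<comment> \<open>The objective reads only \<theta>, which both conversions keep.\<close>
  have "objective_value p \<omega> (x, y, \<theta>) = objective_value p \<omega> (x, y', \<theta>)"
    for x :: "real ^ 'n" and y y' \<theta>
    by (simp add: objective_value_def)
  then show ?thesis
    using Omega_s_to_Omega_z[of _ _ _ Q p C M] Omega_z_to_Omega_s[of _ _ _ Q p C M] by blast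
qed

end
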